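(* Let $E=\{m\in\mathbb{N} : ex(m)\equiv 0 \pmod 2\}$ and $\overline E=\mathbb{N}\setminus E$. If $n$ is a power of $4$, then (a) $(\sqrt n)!^{\sqrt n}\le T(n,E)\le \dfrac{n!}{(\sqrt n)!^{\sqrt n}}$, and (b) $(\sqrt n)!^{\sqrt n}\le T(n,\overline E)\le \dfrac{n!}{(\sqrt n)!^{\sqrt n}}$.
   Context: Here $\mathbb{N}=\{1,2,3,\dots\}$ and $[n]=\{1,\dots,n\}$. For $m\in\mathbb{N}$, $ex(m)$ denotes the largest $s$ such that $2^s$ divides $m$. For $D\subseteq\mathbb{N}$, two permutations $\pi,\sigma$ of $[n]$ are called $G(D)$-different if there is a position $i\in[n]$ with $|\pi(i)-\sigma(i)|\in D$. $T(n,D)$ denotes the maximum cardinality of a set of permutations of $[n]$ any two distinct members of which are $G(D)$-different. *)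

theory Defs
  imports
    Complex_Main
    "HOL-Library.Discrete_Functions"
    "HOL-Computational_Algebra.Primes"
    "HOL-Combinatorics.Permutations"
begin

(* Distances are taken in the integers, so that subtraction does not truncate. *)
definition G_different :: "nat \<Rightarrow> nat set \<Rightarrow> (nat \<Rightarrow> nat) \<Rightarrow> (nat \<Rightarrow> nat) \<Rightarrow> bool" where
  "G_different n D \<pi> \<sigma> \<longleftrightarrow> (\<exists>i\<in>{1..n}. nat \<bar>int (\<pi> i) - int (\<sigma> i)\<bar> \<in> D)"

definition G_different_families :: "nat \<Rightarrow> nat set \<Rightarrow> (nat \<Rightarrow> nat) set set" where
  "G_different_families n D =
     {F. F \<subseteq> {\<pi>. \<pi> permutes {1..n}} \<and> pairwise (G_different n D) F}"

definition T :: "nat \<Rightarrow> nat set \<Rightarrow> nat" where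
  "T n D = Max (card ` G_different_families n D)"

lemma finite_G_different_families: "finite (G_different_families n D)"
  unfolding G_different_families_def
  by (rule finite_subset[of _ "Pow {\<pi>. \<pi> permutes {1..n}}"]) (auto intro: finite_permutations)

lemma empty_in_G_different_families: "{} \<in> G_different_families n D"
  by (simp add: G_different_families_def)

(* The positive integers divisible by 2 to an exactly even power. The type nat contains 0,
   so positivity is required both here and in the complement. *)
definition E :: "nat set" where
  "E = {m. m \<ge> 1 \<and> even (multiplicity 2 m)}"

definition E_compl :: "nat set" where
  "E_compl = {1..} - E"

end

theory Submission
  imports Defs
begin

text \<open>
  Write \<open>x - 1\<close>, for \<open>x\<close> in \<open>{1..4 ^ k}\<close>, with \<open>2 * k\<close> binary digits. The exponent of \<open>2\<close> in
  the difference of two numbers is the lowest position at which their digits differ. Hence two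
  distinct numbers with the same digits at all even positions have a distance in the complement of
  \<open>E\<close>, and two distinct numbers with the same digits at all odd positions have a distance in \<open>E\<close>.
  Either condition splits \<open>{1..4 ^ k}\<close> into \<open>2 ^ k\<close> classes of size \<open>2 ^ k\<close>. The
  \<open>(2 ^ k)! ^ (2 ^ k)\<close> permutations that preserve the classes form a clique for one of the two
  relations and an independent set for the other one. Since these relations are invariant under
  composition with a permutation on the right, a clique and an independent set have sizes whose
  product is at most \<open>n!\<close>.
\<close>

section \<open>Permutations preserving the classes of a labelling\<close>

text \<open>The Young subgroup belonging to the partition of \<open>S\<close> into the fibres of
  \<open>f\<close>.\<close>

definition fibre_permutations :: "'a set \<Rightarrow> ('a \<Rightarrow> 'b) \<Rightarrow> ('a \<Rightarrow> 'a) set" where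
  "fibre_permutations S f = {\<pi>. \<pi> permutes S \<and> (\<forall>x\<in>S. f (\<pi> x) = f x)}"

text \<open>A label-preserving permutation restricts to each fibre, and the restrictions can be
  chosen independently: \<open>split\<close> and \<open>glue\<close> are inverse bijections onto the
  product \<open>P\<close>.\<close>

lemma card_fibre_permutations:
  assumes "finite S"
  shows "card (fibre_permutations S f) = (\<Prod>c\<in>f ` S. fact (card {x\<in>S. f x = c}))"
proof -
  define A where "A c = {x\<in>S. f x = c}" for c
  define P where "P = (\<Pi>\<^sub>E c\<in>f ` S. {p. p permutes A c})"
  define glue where "glue p x = (if x \<in> S then p (f x) x else x)" for p :: "'b \<Rightarrow> 'a \<Rightarrow> 'a" and x
  \<comment> \<open>Each component is the identity off its fibre, as \<open>permutes\<close>
    demands; the family is \<open>undefined\<close> off the image of \<open>f\<close>, as the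
    extensional product demands.\<close>
  define split where
    "split \<pi> = (\<lambda>c\<in>f ` S. \<lambda>x. if x \<in> A c then \<pi> x else x)" for \<pi> :: "'a \<Rightarrow> 'a"
  have finA: "finite (A c)" for c
    using assms by (simp add: A_def)
  have P_perm: "p (f x) permutes A (f x)" if "p \<in> P" "x \<in> S" for p x
    using that by (auto simp: P_def)
  have glue_in_fibre: "glue p x \<in> A (f x)" if "p \<in> P" "x \<in> S" for p x
  proof -
    have "x \<in> A (f x)" using that by (simp add: A_def)
    then show ?thesis
      using permutes_in_image[OF P_perm[OF that]] that by (simp add: glue_def)
  qed
  have split_glue: "split (glue p) = p" if p: "p \<in> P" for p
  proof
    fix c
    show "split (glue p) c = p c"
    proof (cases "c \<in> f ` S")
      case True
      then have "p c permutes A c" using p by (auto simp: P_def)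
      then have "p c x = x" if "x \<notin> A c" for x
        using that by (auto simp: permutes_def)
      then show ?thesis using True by (auto simp: split_def glue_def A_def)
    next
      case False
      then show ?thesis using p by (auto simp: split_def P_def PiE_def extensional_def)
    qed
  qed
  have glue_split: "glue (split \<pi>) = \<pi>" if "\<pi> \<in> fibre_permutations S f" for \<pi>
    using that by (auto simp: fibre_permutations_def glue_def split_def A_def permutes_def)
  have glue_perm: "glue p \<in> fibre_permutations S f" if p: "p \<in> P" for p
  proof -
    have inS: "glue p x \<in> S" and lab: "f (glue p x) = f x" if "x \<in> S" for x
      using glue_in_fibre[OF p that] by (auto simp: A_def)
    have "inj_on (glue p) S"
    proof (rule inj_onI)
      fix x y assume xy: "x \<in> S" "y \<in> S" "glue p x = glue p y"
      then have "f x = f y" using lab by metis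
      then have "p (f x) x = p (f x) y" using xy by (simp add: glue_def)
      then show "x = y" using permutes_inj[OF P_perm[OF p xy(1)]] by (simp add: inj_eq)
    qed
    moreover have "glue p ` S \<subseteq> S" using inS by auto
    ultimately have "bij_betw (glue p) S S"
      using assms by (simp add: bij_betw_def endo_inj_surj)
    then have "glue p permutes S" by (rule bij_imp_permutes) (simp add: glue_def)
    then show ?thesis using lab by (simp add: fibre_permutations_def)
  qed
  have split_P: "split \<pi> \<in> P" if \<pi>: "\<pi> \<in> fibre_permutations S f" for \<pi>
  proof -
    have perm: "\<pi> permutes S" and lab: "\<And>x. x \<in> S \<Longrightarrow> f (\<pi> x) = f x"
      using \<pi> by (auto simp: fibre_permutations_def)
    have "(\<lambda>x. if x \<in> A c then \<pi> x else x) permutes A c" for c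
    proof (rule bij_imp_permutes)
      have "inj_on (\<lambda>x. if x \<in> A c then \<pi> x else x) (A c)"
        using permutes_inj[OF perm] by (auto simp: inj_on_def)
      moreover have "(\<lambda>x. if x \<in> A c then \<pi> x else x) ` A c \<subseteq> A c"
        using lab by (auto simp: A_def permutes_in_image[OF perm])
      ultimately show "bij_betw (\<lambda>x. if x \<in> A c then \<pi> x else x) (A c) (A c)"
        unfolding bij_betw_def using endo_inj_surj[OF finA] by blast
    qed simp
    then show ?thesis by (simp add: P_def split_def)
  qed
  have "bij_betw split (fibre_permutations S f) P"
    by (rule bij_betw_byWitness[where f' = glue])
       (use split_glue glue_split glue_perm split_P in auto)
  then have "card (fibre_permutations S f) = card P" by (rule bij_betw_same_card)
  also have "\<dots> = (\<Prod>c\<in>f ` S. card {p. p permutes A c})"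
    unfolding P_def using assms by (intro card_PiE) simp
  also have "\<dots> = (\<Prod>c\<in>f ` S. fact (card (A c)))"
    using finA by (intro prod.cong refl card_permutations) auto
  finally show ?thesis by (simp add: A_def)
qed

section \<open>Cliques and independent sets\<close>

lemma card_le_T:
  assumes "F \<in> G_different_families n D"
  shows "card F \<le> T n D"
  unfolding T_def using assms finite_G_different_families by (intro Max_ge) auto

lemma T_attained: "\<exists>F\<in>G_different_families n D. card F = T n D"
proof -
  have "T n D \<in> card ` G_different_families n D"
    unfolding T_def using finite_G_different_families empty_in_G_different_families
    by (intro Max_in) blast+
  then show ?thesis by auto
qed

text \<open>For a maximum clique \<open>F\<close>, the map \<open>?h\<close> is injective on
  \<open>F \<times> I\<close>: two clique members that differ in a common quotient would transfer
  their distance in \<open>D\<close> to members of \<open>I\<close>.\<close>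

lemma clique_independent_bound:
  assumes I: "I \<subseteq> {\<pi>. \<pi> permutes {1..n}}"
    and indep: "\<And>\<pi> \<sigma>. \<pi> \<in> I \<Longrightarrow> \<sigma> \<in> I \<Longrightarrow> \<not> G_different n D \<pi> \<sigma>"
  shows "T n D * card I \<le> fact n"
proof -
  obtain F where F: "F \<in> G_different_families n D" and card_F: "card F = T n D"
    using T_attained by blast
  then have F_perm: "\<And>\<pi>. \<pi> \<in> F \<Longrightarrow> \<pi> permutes {1..n}" and pw: "pairwise (G_different n D) F"
    by (auto simp: G_different_families_def)
  let ?h = "\<lambda>(\<pi>, \<iota>). inv \<pi> \<circ> \<iota>"
  have recover: "\<iota> = \<pi> \<circ> (inv \<pi> \<circ> \<iota>)" if "\<pi> \<in> F" for \<pi> \<iota>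
    using permutes_inv_o(1)[OF F_perm[OF that]] by (simp add: o_assoc)
  have "inj_on ?h (F \<times> I)"
  proof (rule inj_onI, clarify)
    fix \<pi>1 \<iota>1 \<pi>2 \<iota>2
    assume mem: "\<pi>1 \<in> F" "\<iota>1 \<in> I" "\<pi>2 \<in> F" "\<iota>2 \<in> I" and eq: "inv \<pi>1 \<circ> \<iota>1 = inv \<pi>2 \<circ> \<iota>2"
    define \<tau> where "\<tau> = inv \<pi>1 \<circ> \<iota>1"
    have \<tau>1: "\<iota>1 = \<pi>1 \<circ> \<tau>" using recover[OF mem(1)] by (simp add: \<tau>_def)
    have \<tau>2: "\<iota>2 = \<pi>2 \<circ> \<tau>" using recover[OF mem(3)] by (simp add: \<tau>_def eq)
    have \<tau>: "\<tau> permutes {1..n}"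
      unfolding \<tau>_def using I mem F_perm by (intro permutes_compose permutes_inv) auto
    have "\<pi>1 = \<pi>2"
    proof (rule ccontr)
      assume "\<pi>1 \<noteq> \<pi>2"
      then have "G_different n D \<pi>1 \<pi>2" using pw mem by (auto simp: pairwise_def)
      then obtain i where i: "i \<in> {1..n}" "nat \<bar>int (\<pi>1 i) - int (\<pi>2 i)\<bar> \<in> D"
        by (auto simp: G_different_def)
      \<comment> \<open>At position \<open>inv \<tau> i\<close> the values of
        \<open>\<iota>1\<close> and \<open>\<iota>2\<close> are \<open>\<pi>1 i\<close> and
        \<open>\<pi>2 i\<close>.\<close>
      have "inv \<tau> i \<in> {1..n}"
        using i(1) permutes_in_image[OF permutes_inv[OF \<tau>]] by blast
      moreover have "\<tau> (inv \<tau> i) = i" using permutes_inverses(1)[OF \<tau>] .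
      ultimately have "G_different n D \<iota>1 \<iota>2"
        using i(2) unfolding G_different_def \<tau>1 \<tau>2 by (metis comp_apply)
      \<comment> \<open>Here \<open>\<iota>1\<close> and \<open>\<iota>2\<close> may coincide;
        \<open>indep\<close> covers that case too.\<close>
      then show False using indep mem by blast
    qed
    then show "\<pi>1 = \<pi>2 \<and> \<iota>1 = \<iota>2" using \<tau>1 \<tau>2 by simp
  qed
  moreover have "?h ` (F \<times> I) \<subseteq> {\<pi>. \<pi> permutes {1..n}}"
    using I F_perm by (auto intro!: permutes_compose permutes_inv)
  ultimately have "card (F \<times> I) \<le> card {\<pi>. \<pi> permutes {1..n}}"
    by (intro card_inj_on_le) (auto intro: finite_permutations)
  then show ?thesis by (simp add: card_F card_cartesian_product card_permutations[OF refl])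
qed

text \<open>Two members of the subgroup send each position to points of the same label, hence at
  distance 0 or in \<open>D\<close>, never in \<open>D'\<close>. So one set serves as a clique for
  \<open>D\<close> and as an independent set for \<open>D'\<close>.\<close>

lemma labelling_bounds:
  assumes D: "\<And>x y. x \<in> {1..n} \<Longrightarrow> y \<in> {1..n} \<Longrightarrow> f x = f y \<Longrightarrow> x \<noteq> y \<Longrightarrow>
                nat \<bar>int x - int y\<bar> \<in> D"
    and D': "D \<inter> D' = {}" "0 \<notin> D'"
  shows "card (fibre_permutations {1..n} f) \<le> T n D"
    and "T n D' * card (fibre_permutations {1..n} f) \<le> fact n"
proof -
  let ?I = "fibre_permutations {1..n} f"
  have perm: "?I \<subseteq> {\<pi>. \<pi> permutes {1..n}}" by (auto simp: fibre_permutations_def)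
  have dist: "nat \<bar>int (\<pi> i) - int (\<sigma> i)\<bar> \<in> D"
    if "\<pi> \<in> ?I" "\<sigma> \<in> ?I" "i \<in> {1..n}" "\<pi> i \<noteq> \<sigma> i" for \<pi> \<sigma> i
  proof (rule D)
    show "\<pi> i \<in> {1..n}" "\<sigma> i \<in> {1..n}"
      using that by (auto simp: fibre_permutations_def dest: permutes_in_image)
    show "f (\<pi> i) = f (\<sigma> i)" using that by (simp add: fibre_permutations_def)
  qed (fact that(4))
  have "pairwise (G_different n D) ?I"
  proof (rule pairwiseI)
    fix \<pi> \<sigma> assume *: "\<pi> \<in> ?I" "\<sigma> \<in> ?I" "\<pi> \<noteq> \<sigma>"
    then obtain i where "\<pi> i \<noteq> \<sigma> i" by auto
    moreover from this have "i \<in> {1..n}"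
      using * by (metis (no_types, lifting) fibre_permutations_def mem_Collect_eq permutes_not_in)
    ultimately show "G_different n D \<pi> \<sigma>"
      unfolding G_different_def using dist * by blast
  qed
  then show "card ?I \<le> T n D"
    using perm by (intro card_le_T) (simp add: G_different_families_def)
  show "T n D' * card ?I \<le> fact n"
  proof (rule clique_independent_bound[OF perm])
    fix \<pi> \<sigma> assume *: "\<pi> \<in> ?I" "\<sigma> \<in> ?I"
    show "\<not> G_different n D' \<pi> \<sigma>"
    proof
      assume "G_different n D' \<pi> \<sigma>"
      then obtain i where "i \<in> {1..n}" and i: "nat \<bar>int (\<pi> i) - int (\<sigma> i)\<bar> \<in> D'"
        by (auto simp: G_different_def)
      then show False using dist[OF *] D' by (cases "\<pi> i = \<sigma> i") auto
    qed
  qed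
qed

section \<open>Binary digits at even and odd positions\<close>

fun even_digits :: "nat \<Rightarrow> nat" where
  "even_digits x = (if x = 0 then 0 else x mod 2 + 2 * even_digits (x div 4))"

declare even_digits.simps [simp del]

definition odd_digits :: "nat \<Rightarrow> nat" where
  "odd_digits x = even_digits (x div 2)"

text \<open>With the definition of \<open>odd_digits\<close>, this shows that halving exchanges the
  two digit strings, so inductions can remove one digit at a time.\<close>

lemma even_digits_rec: "even_digits x = x mod 2 + 2 * odd_digits (x div 2)"
  by (cases "x = 0") (simp_all add: even_digits.simps[of x] odd_digits_def div_mult2_eq[symmetric]
    even_digits.simps[of 0])

lemma even_digits_less: "x < 4 ^ k \<Longrightarrow> even_digits x < 2 ^ k"
proof (induction k arbitrary: x)
  case 0
  then show ?case by (simp add: even_digits.simps)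
next
  case (Suc k)
  then have "even_digits (x div 4) < 2 ^ k" by (simp add: less_mult_imp_div_less mult.commute)
  moreover have "x mod 2 < 2" by simp
  ultimately show ?case unfolding even_digits.simps[of x] by (simp, linarith)
qed

lemma odd_digits_less: "x < 4 ^ k \<Longrightarrow> odd_digits x < 2 ^ k"
  unfolding odd_digits_def by (rule even_digits_less) linarith

text \<open>Both claims are proved in one induction. If the lowest digits agree, halving lowers the
  multiplicity by one and swaps the claims; if not, the distance is odd, which only the second claim
  allows.\<close>

lemma multiplicity_two_distance:
  assumes "x \<noteq> y"
  shows "even_digits x = even_digits y \<Longrightarrow> odd (multiplicity 2 (nat \<bar>int x - int y\<bar>))"
    and "odd_digits x = odd_digits y \<Longrightarrow> even (multiplicity 2 (nat \<bar>int x - int y\<bar>))"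
proof -
  let ?d = "\<lambda>x y. nat \<bar>int x - int y\<bar>"
  have halve: "multiplicity 2 (?d x y) = Suc (multiplicity 2 (?d (x div 2) (y div 2)))"
    and halve_neq: "x div 2 \<noteq> y div 2"
    if "x mod 2 = y mod 2" "x \<noteq> y" for x y :: nat
  proof -
    have x: "x = 2 * (x div 2) + x mod 2" and y: "y = 2 * (y div 2) + x mod 2"
      using that(1) by presburger+
    then show neq: "x div 2 \<noteq> y div 2" using that(2) by metis
    have "?d x y = 2 * ?d (x div 2) (y div 2)"
      using x y by linarith
    \<comment> \<open>The halved distance must be nonzero, since \<open>multiplicity 2 0\<close> is
      0 by convention.\<close>
    then show "multiplicity 2 (?d x y) = Suc (multiplicity 2 (?d (x div 2) (y div 2)))"
      using neq by (simp add: multiplicity_times_same)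
  qed
  have "(even_digits x = even_digits y \<longrightarrow> odd (multiplicity 2 (?d x y))) \<and>
        (odd_digits x = odd_digits y \<longrightarrow> even (multiplicity 2 (?d x y)))"
    using assms
  proof (induction "x + y" arbitrary: x y rule: less_induct)
    case less
    have IH: "(even_digits (x div 2) = even_digits (y div 2) \<longrightarrow>
                 odd (multiplicity 2 (?d (x div 2) (y div 2)))) \<and>
              (odd_digits (x div 2) = odd_digits (y div 2) \<longrightarrow>
                 even (multiplicity 2 (?d (x div 2) (y div 2))))"
      if "x mod 2 = y mod 2"
      \<comment> \<open>Distinctness excludes \<open>x = y = 0\<close>, so halving decreases the
        sum.\<close>
      using halve_neq[OF that less.prems] less.prems by (intro less.hyps) linarith+
    show ?case
    proof (intro conjI impI)
      assume "even_digits x = even_digits y"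
      then have "x mod 2 + 2 * odd_digits (x div 2) = y mod 2 + 2 * odd_digits (y div 2)"
        by (simp add: even_digits_rec)
      then have "x mod 2 = y mod 2" "odd_digits (x div 2) = odd_digits (y div 2)"
        by presburger+
      then show "odd (multiplicity 2 (?d x y))" using IH halve less.prems by simp
    next
      assume eq: "odd_digits x = odd_digits y"
      show "even (multiplicity 2 (?d x y))"
      proof (cases "x mod 2 = y mod 2")
        case True
        then show ?thesis using IH halve less.prems eq by (simp add: odd_digits_def)
      next
        case False
        then have "odd (int x - int y)" by presburger
        then have "\<not> 2 dvd ?d x y" by (simp add: even_nat_iff)
        then show ?thesis by (simp add: not_dvd_imp_multiplicity_0)
      qed
    qed
  qed
  then show "even_digits x = even_digits y \<Longrightarrow> odd (multiplicity 2 (?d x y))"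
    and "odd_digits x = odd_digits y \<Longrightarrow> even (multiplicity 2 (?d x y))" by blast+
qed

text \<open>By counting, the injective pair map fills the whole \<open>m\<close> by \<open>m\<close>
  square, so \<open>h\<close> maps each fibre of \<open>g\<close> bijectively onto
  \<open>{..<m}\<close>.\<close>

lemma card_fibre_of_inj_pair:
  assumes inj: "inj_on (\<lambda>x. (g x, h x)) S" and card: "card S = m * m" and "finite S"
    and g: "\<And>x. x \<in> S \<Longrightarrow> g x < (m::nat)" and h: "\<And>x. x \<in> S \<Longrightarrow> h x < (m::nat)"
    and "c < m"
  shows "card {x\<in>S. g x = c} = m"
proof -
  have image: "(\<lambda>x. (g x, h x)) ` S = {..<m} \<times> {..<m}"
    using assms by (intro card_subset_eq) (auto simp: card_image)
  have "h ` {x\<in>S. g x = c} = {..<m}"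
  proof (intro equalityI subsetI)
    fix d assume "d \<in> {..<m}"
    then have "(c, d) \<in> (\<lambda>x. (g x, h x)) ` S" using \<open>c < m\<close> image by simp
    then show "d \<in> h ` {x\<in>S. g x = c}" by auto
  qed (use h in auto)
  moreover have "inj_on h {x\<in>S. g x = c}"
    using inj by (auto simp: inj_on_def)
  ultimately show ?thesis by (metis card_image card_lessThan)
qed

lemma card_fibre_permutations_inj_pair:
  assumes inj: "inj_on (\<lambda>x. (g x, h x)) S" and card: "card S = m * m" and "finite S"
    and g: "\<And>x. x \<in> S \<Longrightarrow> g x < (m::nat)" and h: "\<And>x. x \<in> S \<Longrightarrow> h x < (m::nat)"
  shows "card (fibre_permutations S g) = fact m ^ m"
proof -
  have fibre: "card {x\<in>S. g x = c} = m" if "c < m" for c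
    using card_fibre_of_inj_pair[OF assms that] .
  have "g ` S = {..<m}"
  proof (intro equalityI subsetI)
    fix c assume "c \<in> {..<m}"
    then have "card {x\<in>S. g x = c} > 0" using fibre[of c] by auto
    then show "c \<in> g ` S" by (auto simp: card_gt_0_iff)
  qed (use g in auto)
  then show ?thesis using fibre by (simp add: card_fibre_permutations[OF \<open>finite S\<close>])
qed

theorem theorem2:
  fixes n :: nat
  assumes "\<exists>k::nat. n = 4 ^ k"
  shows "(fact (floor_sqrt n) ^ floor_sqrt n :: real) \<le> real (T n E) \<and>
         real (T n E) \<le> fact n / fact (floor_sqrt n) ^ floor_sqrt n \<and>
         (fact (floor_sqrt n) ^ floor_sqrt n :: real) \<le> real (T n E_compl) \<and>
         real (T n E_compl) \<le> fact n / fact (floor_sqrt n) ^ floor_sqrt n"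
proof -
  obtain k where k: "n = 4 ^ k" using assms by blast
  define m :: nat where "m = 2 ^ k"
  have nm: "n = m * m" by (simp add: k m_def flip: power_mult_distrib)
  then have sqrt: "floor_sqrt n = m" by (simp flip: power2_eq_square)
  \<comment> \<open>The shift by one moves \<open>{1..n}\<close> to the numbers below
    \<open>4 ^ k\<close> and keeps all distances.\<close>
  let ?e = "\<lambda>x. even_digits (x - 1)" and ?o = "\<lambda>x. odd_digits (x - 1)"
  have odd_dist: "odd (multiplicity 2 (nat \<bar>int x - int y\<bar>))"
    if "x \<in> {1..n}" "y \<in> {1..n}" "?e x = ?e y" "x \<noteq> y" for x y
    using multiplicity_two_distance(1)[of "x - 1" "y - 1"] that by (simp add: of_nat_diff eq_diff_iff)
  have even_dist: "even (multiplicity 2 (nat \<bar>int x - int y\<bar>))"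
    if "x \<in> {1..n}" "y \<in> {1..n}" "?o x = ?o y" "x \<noteq> y" for x y
    using multiplicity_two_distance(2)[of "x - 1" "y - 1"] that by (simp add: of_nat_diff eq_diff_iff)
  \<comment> \<open>Distinct points agreeing in both labels would have a distance of both odd and
    even multiplicity.\<close>
  have inj: "inj_on (\<lambda>x. (?e x, ?o x)) {1..n}" "inj_on (\<lambda>x. (?o x, ?e x)) {1..n}"
    using odd_dist even_dist unfolding inj_on_def by blast+
  have less: "?e x < m" "?o x < m" if "x \<in> {1..n}" for x
  proof -
    have "x - 1 < 4 ^ k" using that k by auto
    then show "?e x < m" "?o x < m"
      unfolding m_def by (rule even_digits_less, rule odd_digits_less)
  qed
  have card: "card (fibre_permutations {1..n} ?e) = fact m ^ m"
    "card (fibre_permutations {1..n} ?o) = fact m ^ m"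
    by (rule card_fibre_permutations_inj_pair[OF inj(1)]; use nm less in simp)
       (rule card_fibre_permutations_inj_pair[OF inj(2)]; use nm less in simp)
  have E: "E \<inter> E_compl = {}" "E_compl \<inter> E = {}" "0 \<notin> E" "0 \<notin> E_compl"
    by (auto simp: E_def E_compl_def)
  have "nat \<bar>int x - int y\<bar> \<in> E_compl"
    if "x \<in> {1..n}" "y \<in> {1..n}" "?e x = ?e y" "x \<noteq> y" for x y
    using odd_dist[OF that] that by (auto simp: E_def E_compl_def)
  \<comment> \<open>The labelling \<open>?e\<close> gives the lower bound of (b) and the upper bound
    of (a).\<close>
  from labelling_bounds[of n ?e, OF this E(2,3)]
  have e: "fact m ^ m \<le> T n E_compl" "T n E * fact m ^ m \<le> fact n"
    unfolding card by blast+
  have "nat \<bar>int x - int y\<bar> \<in> E"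
    if "x \<in> {1..n}" "y \<in> {1..n}" "?o x = ?o y" "x \<noteq> y" for x y
    using even_dist[OF that] that by (auto simp: E_def)
  \<comment> \<open>Symmetrically, \<open>?o\<close> gives the lower bound of (a) and the upper
    bound of (b).\<close>
  from labelling_bounds[of n ?o, OF this E(1,4)]
  have o: "fact m ^ m \<le> T n E" "T n E_compl * fact m ^ m \<le> fact n"
    unfolding card by blast+
  have lower: "(fact m ^ m :: real) \<le> real t" if "fact m ^ m \<le> t" for t
    using of_nat_mono[OF that, where 'a = real] by simp
  have upper: "real t \<le> fact n / fact m ^ m" if "t * fact m ^ m \<le> fact n" for t
    using of_nat_mono[OF that, where 'a = real] by (simp add: field_simps)
  show ?thesis
    unfolding sqrt using e o lower upper by blast
qed

end
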